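(* Let $\Gamma$ be a group with $k$ generators which satisfy some non-trivial positive relation, and let $\ell$ be the minimal length of such a relation. Then $$a_n(\Gamma)\le (n!)^{k-1-\frac{1}{2\ell}+o_n(1)},$$ where $o_n(1)$ denotes a quantity tending to $0$ as $n\to\infty$.
   Context: $a_n(\Gamma)$ denotes the number of subgroups of index $n$ in $\Gamma$. A non-trivial positive relation of length $\ell$ in generators $\gamma_1,\dots,\gamma_k$ of $\Gamma$ is a non-trivial word $w$ of length $\ell$ in the free group $F_k$ on $x_1,\dots,x_k$ which does not involve inverses of the generators $x_i$ and satisfies $w(\gamma_1,\dots,\gamma_k)=1$ in $\Gamma$. *)

theory Defs
  imports Complex_Main "HOL-Algebra.Coset" "HOL-Algebra.Generated_Groups"
begin

text \<open>Elements of the free group on \<open>x\<^sub>0, \<dots>, x\<^sub>k\<^sub>-\<^sub>1\<close> are represented by reduced words.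
  The letter \<open>(i, True)\<close> stands for \<open>x\<^sub>i\<close> and \<open>(i, False)\<close> for its inverse.\<close>

type_synonym letter = "nat \<times> bool"

definition free_group_words :: "nat \<Rightarrow> letter list set" where
  "free_group_words k =
     {w. fst ` set w \<subseteq> {..<k} \<and>
         successively (\<lambda>x y. \<not> (fst x = fst y \<and> snd x \<noteq> snd y)) w}"

definition letter_eval :: "('a, 'b) monoid_scheme \<Rightarrow> (nat \<Rightarrow> 'a) \<Rightarrow> letter \<Rightarrow> 'a" where
  "letter_eval G \<gamma> x = (if snd x then \<gamma> (fst x) else inv\<^bsub>G\<^esub> \<gamma> (fst x))"

primrec word_eval :: "('a, 'b) monoid_scheme \<Rightarrow> (nat \<Rightarrow> 'a) \<Rightarrow> letter list \<Rightarrow> 'a" where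
  "word_eval G \<gamma> [] = \<one>\<^bsub>G\<^esub>"
| "word_eval G \<gamma> (x # w) = letter_eval G \<gamma> x \<otimes>\<^bsub>G\<^esub> word_eval G \<gamma> w"

definition nontrivial_positive_relation ::
    "('a, 'b) monoid_scheme \<Rightarrow> nat \<Rightarrow> (nat \<Rightarrow> 'a) \<Rightarrow> letter list \<Rightarrow> bool" where
  "nontrivial_positive_relation G k \<gamma> w \<longleftrightarrow>
     w \<in> free_group_words k \<and> w \<noteq> [] \<and> (\<forall>x\<in>set w. snd x) \<and> word_eval G \<gamma> w = \<one>\<^bsub>G\<^esub>"

text \<open>The finiteness condition excludes subgroups of infinite index at \<open>n = 0\<close>, where
  \<^const>\<open>card\<close> would conflate them with index \<open>0\<close>. A finitely generated group has only
  finitely many subgroups of each finite index, so for such groups the outer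
  \<^const>\<open>card\<close> is the actual number of subgroups.\<close>

definition num_subgroups_of_index :: "('a, 'b) monoid_scheme \<Rightarrow> nat \<Rightarrow> nat" where
  "num_subgroups_of_index G n =
     card {H. subgroup H G \<and> finite (rcosets\<^bsub>G\<^esub> H) \<and> card (rcosets\<^bsub>G\<^esub> H) = n}"

end

theory Submission
  imports Defs "HOL-Combinatorics.Permutations"
begin

text \<open>
  A subgroup of index \<open>n\<close> together with a numbering of its cosets by \<open>0, \<dots>, n - 1\<close>, in which the
  subgroup itself has number 0, amounts to a transitive action of the group on these numbers.
  The action is given by the maps of the \<open>k\<close> generators, and it satisfies the relation \<open>w\<close>.
  As there are \<open>(n - 1)!\<close> numberings, \<open>a\<^sub>n\<close> is at most the number of \<open>k\<close>-tuples of maps that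
  satisfy \<open>w\<close>, divided by \<open>(n - 1)!\<close> (\<open>num_subgroups_times_fact_le\<close>).

  To count these tuples, view each as a directed graph with \<open>k * n\<close> labelled edges. The walk that
  starts at a point \<open>p\<close> and follows the letters of \<open>w\<close> is back at \<open>p\<close> after \<open>l\<close> steps. Because \<open>w\<close> is
  positive, all edges are traversed forwards, so the edge along which the walk first returns to \<open>p\<close>
  points at \<open>p\<close>, and its target need not be recorded once its source and label are known. These
  closing edges are different for different \<open>p\<close>. The closing edges of several points
  can be omitted simultaneously if the points can be ordered such that no walk meets a later
  point; a greedy choice yields at least \<open>n / l\<close> such points (\<open>greedy_scattered_set\<close>,
  \<open>closed_table_reconstruct\<close>). It suffices to record the set of omitted edges, the return
  times, and the targets of the remaining edges, of which there are at most \<open>k * n - n / l\<close>. This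
  gives at most \<open>C ^ n * n powr (k * n - n / l)\<close> tuples (\<open>card_closed_tables\<close>).

  Up to exponential factors, \<open>n ^ n\<close> is \<open>n!\<close>, so \<open>a\<^sub>n\<close> is at most an exponential times
  \<open>n! powr (k - 1 - 1 / l)\<close>. Replacing \<open>1 / l\<close> by \<open>1 / (2 * l)\<close> absorbs the exponential,
  and the error term can even be chosen to vanish for all large \<open>n\<close>.
\<close>

section \<open>Walks along a word and their closing edges\<close>

primrec walk :: "(nat \<times> nat \<Rightarrow> nat) \<Rightarrow> (nat \<Rightarrow> nat) \<Rightarrow> nat \<Rightarrow> nat \<Rightarrow> nat" where
  "walk f u p 0 = p"
| "walk f u p (Suc i) = f (u i, walk f u p i)"

definition return_time :: "(nat \<times> nat \<Rightarrow> nat) \<Rightarrow> (nat \<Rightarrow> nat) \<Rightarrow> nat \<Rightarrow> nat" where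
  "return_time f u p = (LEAST j. 0 < j \<and> walk f u p j = p)"

text \<open>An entry \<open>(i, x)\<close> of a table \<open>f\<close> is viewed as an edge with label \<open>i\<close> from \<open>x\<close> to \<open>f (i, x)\<close>.
The closing edge of \<open>p\<close> is the edge along which the walk from \<open>p\<close> first comes back to \<open>p\<close>.\<close>
definition closing_edge :: "(nat \<times> nat \<Rightarrow> nat) \<Rightarrow> (nat \<Rightarrow> nat) \<Rightarrow> nat \<Rightarrow> nat \<times> nat" where
  "closing_edge f u p =
     (u (return_time f u p - 1), walk f u p (return_time f u p - 1))"

text \<open>The \<open>k\<close>-tuples of self-maps of \<open>{..<n}\<close> for which the positive word
\<open>u 0, \<dots>, u (l - 1)\<close>, read from left to right, is the identity.\<close>
definition closed_tables :: "nat \<Rightarrow> (nat \<Rightarrow> nat) \<Rightarrow> nat \<Rightarrow> nat \<Rightarrow> (nat \<times> nat \<Rightarrow> nat) set" where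
  "closed_tables k u l n =
     {f \<in> ({..<k} \<times> {..<n}) \<rightarrow>\<^sub>E {..<n}. \<forall>p<n. walk f u p l = p}"

lemma walk_less:
  assumes "f \<in> ({..<k} \<times> {..<n}) \<rightarrow>\<^sub>E {..<n}" "\<And>i. i < l \<Longrightarrow> u i < k" "p < n" "i \<le> l"
  shows "walk f u p i < n"
  using assms(4)
proof (induction i)
  case 0 then show ?case using assms by simp
next
  case (Suc i)
  then have "(u i, walk f u p i) \<in> {..<k} \<times> {..<n}" using assms(2) by simp
  from PiE_mem[OF assms(1) this] show ?case by simp
qed

lemma return_time:
  assumes "0 < l" "walk f u p l = p"
  shows "0 < return_time f u p" "return_time f u p \<le> l"
    "walk f u p (return_time f u p) = p"
    "\<And>i. 0 < i \<Longrightarrow> i < return_time f u p \<Longrightarrow> walk f u p i \<noteq> p"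
proof -
  have *: "0 < return_time f u p \<and> walk f u p (return_time f u p) = p"
    unfolding return_time_def by (rule LeastI[of _ l]) (use assms in simp)
  then show "0 < return_time f u p" "walk f u p (return_time f u p) = p" by auto
  show "return_time f u p \<le> l"
    unfolding return_time_def by (rule Least_le) (use assms in simp)
  show "walk f u p i \<noteq> p" if "0 < i" "i < return_time f u p" for i
    using not_less_Least[OF that(2)[unfolded return_time_def]] that(1) by simp
qed

lemma table_closing_edge:
  assumes "0 < l" "walk f u p l = p"
  shows "f (closing_edge f u p) = p"
proof -
  obtain j where j: "return_time f u p = Suc j"
    using return_time(1)[OF assms] gr0_implies_Suc by blast
  then show ?thesis using return_time(3)[OF assms] by (simp add: closing_edge_def)
qed

lemma closing_edge_mem:
  assumes "f \<in> closed_tables k u l n" "\<And>i. i < l \<Longrightarrow> u i < k" "0 < l" "p < n"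
  shows "closing_edge f u p \<in> {..<k} \<times> {..<n}"
proof -
  have f: "f \<in> ({..<k} \<times> {..<n}) \<rightarrow>\<^sub>E {..<n}" and w: "walk f u p l = p"
    using assms by (auto simp: closed_tables_def)
  show ?thesis
    using return_time(1,2)[OF assms(3) w] assms(2)[of "return_time f u p - 1"]
      walk_less[OF f assms(2) assms(4), of "return_time f u p - 1"]
    by (simp add: closing_edge_def)
qed

section \<open>Counting the tables that satisfy a positive word\<close>

text \<open>Going through the points in increasing order, a point is selected unless an already selected
one covers it. The sets \<open>t q\<close> of the selected points then cover everything, which gives the
lower bound on their number.\<close>
lemma greedy_scattered_set:
  fixes t :: "nat \<Rightarrow> nat set"
  assumes "\<And>p. p < n \<Longrightarrow> p \<in> t p" "\<And>p. finite (t p)" "\<And>p. card (t p) \<le> l"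
  shows "\<exists>P \<subseteq> {..<n}. (\<forall>q\<in>P. \<forall>p\<in>P. q < p \<longrightarrow> p \<notin> t q) \<and> n \<le> l * card P"
proof -
  have "\<exists>P \<subseteq> {..<m}. (\<forall>q\<in>P. \<forall>p\<in>P. q < p \<longrightarrow> p \<notin> t q) \<and> {..<m} \<subseteq> (\<Union>q\<in>P. t q)"
    if "m \<le> n" for m
    using that
  proof (induction m)
    case 0 then show ?case by auto
  next
    case (Suc m)
    then obtain P where P: "P \<subseteq> {..<m}" "\<forall>q\<in>P. \<forall>p\<in>P. q < p \<longrightarrow> p \<notin> t q"
      "{..<m} \<subseteq> (\<Union>q\<in>P. t q)" by auto
    show ?case
    proof (cases "m \<in> (\<Union>q\<in>P. t q)")
      case True
      then show ?thesis using P by (intro exI[of _ P]) (auto simp: lessThan_Suc)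
    next
      case False
      then show ?thesis using P assms(1)[of m] Suc.prems
        by (intro exI[of _ "insert m P"]) (auto simp: lessThan_Suc)
    qed
  qed
  from this[OF order_refl] obtain P where P: "P \<subseteq> {..<n}"
    "\<forall>q\<in>P. \<forall>p\<in>P. q < p \<longrightarrow> p \<notin> t q" "{..<n} \<subseteq> (\<Union>q\<in>P. t q)" by blast
  have fin: "finite P" using P(1) finite_subset by blast
  have "n \<le> card (\<Union>q\<in>P. t q)" using card_mono[OF _ P(3)] fin assms(2) by simp
  also have "\<dots> \<le> (\<Sum>q\<in>P. card (t q))" using card_UN_le[OF fin] .
  also have "\<dots> \<le> l * card P" using sum_bounded_above[of P "\<lambda>q. card (t q)" l] assms(3) by (simp add: mult.commute)
  finally show ?thesis using P by blast
qed

text \<open>This is where a factor \<open>n\<close> is saved for every point of \<open>P\<close>. The values of a table at the closing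
edges of \<open>P\<close> are redundant: they are the points of \<open>P\<close>, and it only has to be found out
which edge belongs to which point. For the smallest point this is done by following the walk up to
its return, since that part of the walk meets no other point of \<open>P\<close> and hence no other closing
edge. The walk from a later point \<open>p\<close> can meet only smaller points of \<open>P\<close> before it returns,
whose closing edges are known by then.\<close>
lemma closed_table_reconstruct:
  assumes f: "f \<in> closed_tables k u l n" and g: "g \<in> closed_tables k u l n"
    and u: "\<And>i. i < l \<Longrightarrow> u i < k" and l: "0 < l"
    and P: "P \<subseteq> {..<n}"
    and scattered: "\<forall>q\<in>P. \<forall>p\<in>P. q < p \<longrightarrow> p \<notin> walk f u q ` {..<l}"
    and times: "\<forall>p\<in>P. return_time f u p = return_time g u p"
    and edges: "closing_edge f u ` P = closing_edge g u ` P"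
    and agree: "\<And>e. e \<notin> closing_edge f u ` P \<Longrightarrow> f e = g e"
  shows "f = g"
proof -
  have wf: "walk f u p l = p" and wg: "walk g u p l = p" if "p \<in> P" for p
    using f g that P by (auto simp: closed_tables_def)
  have same: "closing_edge f u p = closing_edge g u p" if "p \<in> P" for p
    using that
  proof (induction p rule: less_induct)
    case (less p)
    define r where "r = return_time f u p"
    have r: "0 < r" "r \<le> l" "\<And>i. 0 < i \<Longrightarrow> i < r \<Longrightarrow> walk f u p i \<noteq> p"
      using return_time[OF l wf[OF less.prems]] by (auto simp: r_def)
    \<comment> \<open>Strictly before the return time, every closing edge on the walk belongs to a smaller point.\<close>
    have walks: "walk f u p i = walk g u p i" if "i < r" for i
      using that
    proof (induction i)
      case 0 then show ?case by simp
    next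
      case (Suc i)
      define e where "e = (u i, walk f u p i)"
      have "f e = g e"
      proof (cases "e \<in> closing_edge f u ` P")
        case True
        then obtain q where q: "q \<in> P" "e = closing_edge f u q" by auto
        have fq: "f e = q" using table_closing_edge[OF l wf[OF q(1)]] q(2) by simp
        have wq: "walk f u p (Suc i) = q" using fq by (simp add: e_def)
        have "q \<noteq> p" using r(3)[of "Suc i"] Suc.prems wq by auto
        moreover have "q \<in> walk f u p ` {..<l}" using wq Suc.prems r(2)
          by (metis image_eqI lessThan_iff less_le_trans)
        ultimately have "q < p" using scattered less.prems q(1) by (meson linorder_neqE_nat)
        then have "e = closing_edge g u q" using less.IH q by simp
        then show ?thesis using fq table_closing_edge[OF l wg[OF q(1)]] by simp
      qed (use agree in blast)
      then show ?case using Suc by (simp add: e_def)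
    qed
    show ?case using walks[of "r - 1"] r(1) times less.prems
      by (simp add: closing_edge_def r_def)
  qed
  show "f = g"
  proof
    fix e show "f e = g e"
    proof (cases "e \<in> closing_edge f u ` P")
      case True
      then obtain p where p: "p \<in> P" "e = closing_edge f u p" by auto
      then show ?thesis
        using table_closing_edge[OF l wf[OF p(1)]] table_closing_edge[OF l wg[OF p(1)]] same[OF p(1)] by simp
    qed (use agree in blast)
  qed
qed

text \<open>The closed tables with a prescribed set of closing edges and prescribed return times, for some
admissible choice of the points \<open>P\<close>. The value 0 of \<open>J\<close> marks the points outside \<open>P\<close>; it is
free for this purpose because return times are positive, so that \<open>J\<close> alone determines \<open>P\<close>.\<close>
definition table_class :: "nat \<Rightarrow> (nat \<Rightarrow> nat) \<Rightarrow> nat \<Rightarrow> nat \<Rightarrow> (nat \<times> nat) set \<Rightarrow> (nat \<Rightarrow> nat)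
    \<Rightarrow> (nat \<times> nat \<Rightarrow> nat) set" where
  "table_class k u l n E J =
     {f \<in> closed_tables k u l n. \<exists>P \<subseteq> {..<n}.
        J = (\<lambda>p\<in>{..<n}. if p \<in> P then return_time f u p else 0) \<and>
        E = closing_edge f u ` P \<and> n \<le> l * card P \<and>
        (\<forall>q\<in>P. \<forall>p\<in>P. q < p \<longrightarrow> p \<notin> walk f u q ` {..<l})}"

text \<open>A table of the class is determined by its values off \<open>E\<close>, and \<open>E\<close> has at least \<open>n / l\<close> elements
because distinct points have distinct closing edges.\<close>
lemma card_table_class:
  assumes u: "\<And>i. i < l \<Longrightarrow> u i < k" and l: "0 < l" and n: "0 < n"
  shows "real (card (table_class k u l n E J)) \<le> real n powr (real k * n - real n / l)"
proof (cases "table_class k u l n E J = {}")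
  case True then show ?thesis by simp
next
  case False
  have support: "P = {p \<in> {..<n}. J p \<noteq> 0}"
    if "f \<in> closed_tables k u l n" "P \<subseteq> {..<n}" "J = (\<lambda>p\<in>{..<n}. if p \<in> P then return_time f u p else 0)" for f P
  proof -
    have "return_time f u p \<noteq> 0" if "p < n" for p
      using return_time(1)[OF l, of f u p] \<open>f \<in> _\<close> that by (simp add: closed_tables_def)
    then show ?thesis using that(2) by (subst that(3)) auto
  qed
  from False obtain f0 P where f0: "f0 \<in> closed_tables k u l n" "P \<subseteq> {..<n}"
      "E = closing_edge f0 u ` P" "n \<le> l * card P"
    by (auto simp: table_class_def)
  have "inj_on (closing_edge f0 u) P"
  proof (rule inj_on_inverseI[of _ f0])
    fix p assume "p \<in> P"
    then show "f0 (closing_edge f0 u p) = p"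
      using f0(1,2) by (intro table_closing_edge[OF l, of f0 u]) (auto simp: closed_tables_def)
  qed
  then have cE: "card E = card P" using f0(3) card_image by blast
  have Esub: "E \<subseteq> {..<k} \<times> {..<n}"
    using f0(2) closing_edge_mem[OF f0(1) u l] unfolding f0(3) by blast
  let ?D = "{..<k} \<times> {..<n} - E"
  have "inj_on (\<lambda>f. restrict f ?D) (table_class k u l n E J)"
  proof (rule inj_onI)
    fix f g assume f: "f \<in> table_class k u l n E J" and g: "g \<in> table_class k u l n E J"
      and eq: "restrict f ?D = restrict g ?D"
    from f obtain P where P: "f \<in> closed_tables k u l n" "P \<subseteq> {..<n}"
      "J = (\<lambda>p\<in>{..<n}. if p \<in> P then return_time f u p else 0)" "E = closing_edge f u ` P"
      "\<forall>q\<in>P. \<forall>p\<in>P. q < p \<longrightarrow> p \<notin> walk f u q ` {..<l}"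
      by (auto simp: table_class_def)
    from g obtain Q where Q: "g \<in> closed_tables k u l n" "Q \<subseteq> {..<n}"
      "J = (\<lambda>p\<in>{..<n}. if p \<in> Q then return_time g u p else 0)" "E = closing_edge g u ` Q"
      by (auto simp: table_class_def)
    have QP: "Q = P" using support[OF P(1,2,3)] support[OF Q(1,2,3)] by simp
    show "f = g"
    proof (rule closed_table_reconstruct[OF P(1) Q(1) u l P(2) P(5)])
      show "\<forall>p\<in>P. return_time f u p = return_time g u p"
      proof
        fix p assume p: "p \<in> P"
        then have "p < n" using P(2) by auto
        then show "return_time f u p = return_time g u p"
          using fun_cong[OF P(3), of p] fun_cong[OF Q(3), of p] p QP by simp
      qed
      show "closing_edge f u ` P = closing_edge g u ` P" using P(4) Q(4) QP by simp
      fix e assume "e \<notin> closing_edge f u ` P"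
      then have e: "e \<notin> E" using P(4) by simp
      show "f e = g e"
      proof (cases "e \<in> {..<k} \<times> {..<n}")
        case True then show ?thesis using fun_cong[OF eq, of e] e by simp
      next
        case False
        have "f \<in> ({..<k} \<times> {..<n}) \<rightarrow>\<^sub>E {..<n}" "g \<in> ({..<k} \<times> {..<n}) \<rightarrow>\<^sub>E {..<n}"
          using P(1) Q(1) by (auto simp: closed_tables_def)
        then show ?thesis using False by (simp add: PiE_arb[of f] PiE_arb[of g])
      qed
    qed
  qed
  moreover have "(\<lambda>f. restrict f ?D) ` table_class k u l n E J \<subseteq> ?D \<rightarrow>\<^sub>E {..<n}"
  proof clarify
    fix f assume "f \<in> table_class k u l n E J"
    then have "f \<in> ({..<k} \<times> {..<n}) \<rightarrow>\<^sub>E {..<n}" by (simp add: table_class_def closed_tables_def)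
    then show "restrict f ?D \<in> ?D \<rightarrow>\<^sub>E {..<n}" using PiE_mem by (intro restrict_PiE_iff[THEN iffD2]) blast
  qed
  ultimately have "card (table_class k u l n E J) \<le> card (?D \<rightarrow>\<^sub>E {..<n})"
    by (rule card_inj_on_le) (auto intro: finite_PiE)
  also have "\<dots> = n ^ card ?D" by (simp add: card_PiE)
  also have "card ?D = k * n - card E" using Esub
    by (subst card_Diff_subset) (auto intro: finite_subset)
  finally have "real (card (table_class k u l n E J)) \<le> real n ^ (k * n - card E)"
    by (metis of_nat_le_iff of_nat_power)
  also have "\<dots> = real n powr real (k * n - card E)" using n by (simp add: powr_realpow)
  also have "\<dots> \<le> real n powr (real k * n - real n / l)"
  proof (rule powr_mono)
    have "card E \<le> k * n" using card_mono[OF _ Esub] by simp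
    then have "real (k * n - card E) = real k * n - card E" by (simp add: of_nat_diff)
    moreover have "real n \<le> real l * card E" using f0(4) cE by (metis of_nat_le_iff of_nat_mult)
    then have "real n / l \<le> card E" using l by (simp add: field_simps)
    ultimately show "real (k * n - card E) \<le> real k * n - real n / l" by simp
  qed (use n in simp)
  finally show ?thesis .
qed

lemma closed_tables_cover:
  assumes u: "\<And>i. i < l \<Longrightarrow> u i < k" and l: "0 < l"
  shows "closed_tables k u l n \<subseteq>
    (\<Union>(E, J) \<in> Pow ({..<k} \<times> {..<n}) \<times> ({..<n} \<rightarrow>\<^sub>E {..l}). table_class k u l n E J)"
proof
  fix f assume f: "f \<in> closed_tables k u l n"
  have wf: "walk f u p l = p" if "p < n" for p using f that by (simp add: closed_tables_def)
  have "\<exists>P \<subseteq> {..<n}. (\<forall>q\<in>P. \<forall>p\<in>P. q < p \<longrightarrow> p \<notin> walk f u q ` {..<l}) \<and> n \<le> l * card P"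
  proof (rule greedy_scattered_set)
    fix p :: nat
    show "p \<in> walk f u p ` {..<l}" using l by (auto intro: image_eqI[of _ _ 0])
    show "card (walk f u p ` {..<l}) \<le> l" using card_image_le[of "{..<l}"] by simp
  qed simp
  then obtain P where P: "P \<subseteq> {..<n}"
    "\<forall>q\<in>P. \<forall>p\<in>P. q < p \<longrightarrow> p \<notin> walk f u q ` {..<l}" "n \<le> l * card P" by blast
  define J where "J = (\<lambda>p\<in>{..<n}. if p \<in> P then return_time f u p else 0)"
  have "f \<in> table_class k u l n (closing_edge f u ` P) J"
    unfolding table_class_def using f P J_def by blast
  moreover have "closing_edge f u ` P \<in> Pow ({..<k} \<times> {..<n})"
    using closing_edge_mem[OF f u l] P(1) by blast
  moreover have "J \<in> {..<n} \<rightarrow>\<^sub>E {..l}"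
    unfolding J_def restrict_PiE_iff using return_time(2)[OF l wf] by auto
  ultimately show "f \<in> (\<Union>(E, J) \<in> Pow ({..<k} \<times> {..<n}) \<times> ({..<n} \<rightarrow>\<^sub>E {..l}). table_class k u l n E J)"
    by blast
qed

text \<open>There are only exponentially many classes: \<open>2 ^ (k * n)\<close> choices of \<open>E\<close> and
\<open>(l + 1) ^ n\<close> choices of \<open>J\<close>.\<close>
theorem card_closed_tables:
  assumes u: "\<And>i. i < l \<Longrightarrow> u i < k" and l: "0 < l" and n: "0 < n"
  shows "real (card (closed_tables k u l n))
    \<le> (2 ^ k * (real l + 1)) ^ n * real n powr (real k * n - real n / l)"
proof -
  let ?I = "Pow ({..<k} \<times> {..<n}) \<times> ({..<n} \<rightarrow>\<^sub>E {..l})"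
  let ?C = "\<lambda>(E, J). table_class k u l n E J"
  have finI: "finite ?I" by (simp add: finite_PiE)
  have fin: "finite (closed_tables k u l n)"
    unfolding closed_tables_def by (rule finite_subset[of _ "({..<k} \<times> {..<n}) \<rightarrow>\<^sub>E {..<n}"]) (auto intro: finite_PiE)
  have "finite (?C x)" for x
    by (cases x) (auto intro: finite_subset[OF _ fin] simp: table_class_def)
  then have "card (closed_tables k u l n) \<le> card (\<Union>x\<in>?I. ?C x)"
    using closed_tables_cover[OF u l] finI by (intro card_mono) auto
  also have "\<dots> \<le> (\<Sum>x\<in>?I. card (?C x))" by (rule card_UN_le[OF finI])
  finally have "real (card (closed_tables k u l n)) \<le> (\<Sum>x\<in>?I. real (card (?C x)))"
    unfolding of_nat_sum[symmetric] by (rule of_nat_mono)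
  also have "\<dots> \<le> real (card ?I) * real n powr (real k * n - real n / l)"
    by (rule sum_bounded_above) (auto intro: card_table_class[OF u l n])
  also have "card ?I = 2 ^ (k * n) * (l + 1) ^ n"
    by (simp add: card_cartesian_product card_Pow card_PiE)
  finally show ?thesis by (simp add: power_mult_distrib power_mult add.commute)
qed

section \<open>Subgroups of index n as closed tables\<close>

text \<open>The action of the generators on the right cosets of \<open>H\<close> by right multiplication, transported to
\<open>{..<n}\<close> along the numbering \<open>\<psi>\<close>.\<close>
definition coset_table ::
    "('a, 'b) monoid_scheme \<Rightarrow> nat \<Rightarrow> (nat \<Rightarrow> 'a) \<Rightarrow> nat \<Rightarrow> 'a set \<Rightarrow> ('a set \<Rightarrow> nat) \<Rightarrow> nat \<times> nat \<Rightarrow> nat" where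
  "coset_table G k \<gamma> n H \<psi> =
     (\<lambda>(i, x) \<in> {..<k} \<times> {..<n}. \<psi> (the_inv_into (rcosets\<^bsub>G\<^esub> H) \<psi> x #>\<^bsub>G\<^esub> \<gamma> i))"

context group
begin

lemma coset_table_apply:
  assumes H: "subgroup H G" and \<psi>: "bij_betw \<psi> (rcosets H) {..<n}"
    and x: "x \<in> carrier G" and i: "i < k" and \<gamma>: "\<gamma> ` {..<k} \<subseteq> carrier G"
  shows "coset_table G k \<gamma> n H \<psi> (i, \<psi> (H #> x)) = \<psi> (H #> (x \<otimes> \<gamma> i))"
proof -
  have HG: "H \<subseteq> carrier G" using H by (rule subgroup.subset)
  have g: "\<gamma> i \<in> carrier G" using i \<gamma> by auto
  have C: "H #> x \<in> rcosets H" using rcosetsI[OF HG x] .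
  have "\<psi> (H #> x) < n" using bij_betwE[OF \<psi>] C by blast
  moreover have "the_inv_into (rcosets H) \<psi> (\<psi> (H #> x)) = H #> x"
    using the_inv_into_f_f[OF bij_betw_imp_inj_on[OF \<psi>] C] .
  ultimately show ?thesis using i g x HG by (simp add: coset_table_def coset_mult_assoc)
qed

lemma coset_table_in_PiE:
  assumes H: "subgroup H G" and \<psi>: "bij_betw \<psi> (rcosets H) {..<n}"
    and \<gamma>: "\<gamma> ` {..<k} \<subseteq> carrier G"
  shows "coset_table G k \<gamma> n H \<psi> \<in> ({..<k} \<times> {..<n}) \<rightarrow>\<^sub>E {..<n}"
proof (rule PiE_I)
  fix e assume "e \<in> {..<k} \<times> {..<n}"
  then obtain i y where e: "e = (i, y)" "i < k" "y < n" by auto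
  have HG: "H \<subseteq> carrier G" using H by (rule subgroup.subset)
  obtain C where "C \<in> rcosets H" "y = \<psi> C"
    using \<psi> e(3) by (metis bij_betw_imp_surj_on imageE lessThan_iff)
  then obtain x where x: "x \<in> carrier G" "y = \<psi> (H #> x)" unfolding RCOSETS_def by auto
  have g: "\<gamma> i \<in> carrier G" using \<gamma> e(2) by auto
  have "H #> (x \<otimes> \<gamma> i) \<in> rcosets H" using x g HG by (intro rcosetsI) auto
  then show "coset_table G k \<gamma> n H \<psi> e \<in> {..<n}"
    using coset_table_apply[OF H \<psi> x(1) e(2) \<gamma>] bij_betwE[OF \<psi>] e(1) x(2) by auto
qed (auto simp: coset_table_def)

lemma word_eval_closed:
  assumes "\<gamma> ` {..<k} \<subseteq> carrier G" "fst ` set w \<subseteq> {..<k}"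
  shows "word_eval G \<gamma> w \<in> carrier G"
  using assms(2)
proof (induction w)
  case Nil then show ?case by simp
next
  case (Cons a w)
  then have "\<gamma> (fst a) \<in> carrier G" using assms(1) by auto
  then show ?case using Cons by (simp add: letter_eval_def)
qed

lemma word_eval_snoc:
  assumes "\<gamma> ` {..<k} \<subseteq> carrier G" "fst ` set w \<subseteq> {..<k}" "i < k"
  shows "word_eval G \<gamma> (w @ [(i, True)]) = word_eval G \<gamma> w \<otimes> \<gamma> i"
  using assms(2)
proof (induction w)
  case Nil then show ?case using assms by (auto simp: letter_eval_def)
next
  case (Cons a w)
  have "\<gamma> (fst a) \<in> carrier G" "\<gamma> i \<in> carrier G" using Cons.prems assms(1,3) by auto
  moreover have "word_eval G \<gamma> w \<in> carrier G" using word_eval_closed[OF assms(1)] Cons.prems by auto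
  ultimately show ?case using Cons by (simp add: letter_eval_def m_assoc)
qed

lemma walk_coset_table:
  assumes H: "subgroup H G" and \<psi>: "bij_betw \<psi> (rcosets H) {..<n}"
    and \<gamma>: "\<gamma> ` {..<k} \<subseteq> carrier G"
    and w: "fst ` set w \<subseteq> {..<k}" "\<forall>a\<in>set w. snd a" and x: "x \<in> carrier G"
    and j: "j \<le> length w"
  shows "walk (coset_table G k \<gamma> n H \<psi>) (\<lambda>i. fst (w ! i)) (\<psi> (H #> x)) j
    = \<psi> (H #> (x \<otimes> word_eval G \<gamma> (take j w)))"
  using j
proof (induction j)
  case 0 then show ?case using x by simp
next
  case (Suc j)
  let ?v = "take j w"
  have mem: "w ! j \<in> set w" using Suc.prems by simp
  then have i: "fst (w ! j) < k" and g: "\<gamma> (fst (w ! j)) \<in> carrier G" using w(1) \<gamma> by auto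
  have v: "fst ` set ?v \<subseteq> {..<k}" using w(1) set_take_subset[of j w] by blast
  have wv: "word_eval G \<gamma> ?v \<in> carrier G" using word_eval_closed[OF \<gamma> v] .
  have "w ! j = (fst (w ! j), True)" using w(2) mem by (metis prod.collapse)
  then have "take (Suc j) w = ?v @ [(fst (w ! j), True)]"
    using Suc.prems by (metis Suc_le_lessD take_Suc_conv_app_nth)
  then have "word_eval G \<gamma> (take (Suc j) w) = word_eval G \<gamma> ?v \<otimes> \<gamma> (fst (w ! j))"
    using word_eval_snoc[OF \<gamma> v i] by simp
  then show ?case
    using Suc coset_table_apply[OF H \<psi> m_closed[OF x wv] i \<gamma>] x wv g by (simp add: m_assoc)
qed

lemma coset_table_closed:
  assumes H: "subgroup H G" and \<psi>: "bij_betw \<psi> (rcosets H) {..<n}"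
    and \<gamma>: "\<gamma> ` {..<k} \<subseteq> carrier G"
    and w: "nontrivial_positive_relation G k \<gamma> w"
  shows "coset_table G k \<gamma> n H \<psi> \<in> closed_tables k (\<lambda>i. fst (w ! i)) (length w) n"
proof -
  have w': "fst ` set w \<subseteq> {..<k}" "\<forall>a\<in>set w. snd a" "word_eval G \<gamma> w = \<one>"
    using w by (auto simp: nontrivial_positive_relation_def free_group_words_def)
  have "walk (coset_table G k \<gamma> n H \<psi>) (\<lambda>i. fst (w ! i)) p (length w) = p" if "p < n" for p
  proof -
    obtain C where "C \<in> rcosets H" "p = \<psi> C"
      using \<psi> \<open>p < n\<close> by (metis bij_betw_imp_surj_on imageE lessThan_iff)
    then obtain x where x: "x \<in> carrier G" "p = \<psi> (H #> x)" unfolding RCOSETS_def by auto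
    show ?thesis
      using walk_coset_table[OF H \<psi> \<gamma> w'(1,2) x(1) order_refl] w'(3) x by simp
  qed
  then show ?thesis using coset_table_in_PiE[OF H \<psi> \<gamma>] by (simp add: closed_tables_def)
qed

text \<open>The coset \<open>H\<close> has number 0 and the generators act in the same way in both numberings, so agreement
spreads from the trivial coset to all cosets, along a product of generators and their inverses.
Inverse generators are covered because right multiplication is invertible, which makes \<open>step\<close>
an equivalence.\<close>
lemma coset_table_determines_numbering:
  assumes H: "subgroup H G" and \<psi>: "bij_betw \<psi> (rcosets H) {..<n}" and \<psi>0: "\<psi> H = 0"
    and H': "subgroup H' G" and \<psi>': "bij_betw \<psi>' (rcosets H') {..<n}" and \<psi>'0: "\<psi>' H' = 0"
    and \<gamma>: "\<gamma> ` {..<k} \<subseteq> carrier G" and gen: "generate G (\<gamma> ` {..<k}) = carrier G"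
    and eq: "coset_table G k \<gamma> n H \<psi> = coset_table G k \<gamma> n H' \<psi>'"
    and g: "g \<in> carrier G"
  shows "\<psi> (H #> g) = \<psi>' (H' #> g)"
proof -
  have HG: "H \<subseteq> carrier G" and HG': "H' \<subseteq> carrier G"
    using H H' by (auto dest: subgroup.subset)
  have step: "\<psi> (H #> (x \<otimes> \<gamma> i)) = \<psi>' (H' #> (x \<otimes> \<gamma> i)) \<longleftrightarrow> \<psi> (H #> x) = \<psi>' (H' #> x)"
    if x: "x \<in> carrier G" and i: "i < k" for x i
  proof -
    have gi: "\<gamma> i \<in> carrier G" using \<gamma> i by auto
    let ?T = "coset_table G k \<gamma> n H \<psi>"
    have T: "?T (i, \<psi> (H #> x)) = \<psi> (H #> (x \<otimes> \<gamma> i))"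
      "?T (i, \<psi>' (H' #> x)) = \<psi>' (H' #> (x \<otimes> \<gamma> i))"
      using coset_table_apply[OF H \<psi> x i \<gamma>] coset_table_apply[OF H' \<psi>' x i \<gamma>] eq by auto
    obtain y where y: "y \<in> carrier G" "\<psi>' (H' #> x) = \<psi> (H #> y)"
    proof -
      have "\<psi>' (H' #> x) < n" using bij_betwE[OF \<psi>'] rcosetsI[OF HG' x] by blast
      then obtain C where "C \<in> rcosets H" "\<psi>' (H' #> x) = \<psi> C"
        using \<psi> by (metis bij_betw_imp_surj_on imageE lessThan_iff)
      then show ?thesis using that unfolding RCOSETS_def by auto
    qed
    have Ty: "?T (i, \<psi> (H #> y)) = \<psi> (H #> (y \<otimes> \<gamma> i))"
      using coset_table_apply[OF H \<psi> y(1) i \<gamma>] .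
    have inj: "inj_on \<psi> (rcosets H)" using \<psi> by (rule bij_betw_imp_inj_on)
    show ?thesis
    proof
      assume "\<psi> (H #> (x \<otimes> \<gamma> i)) = \<psi>' (H' #> (x \<otimes> \<gamma> i))"
      then have "\<psi> (H #> (x \<otimes> \<gamma> i)) = \<psi> (H #> (y \<otimes> \<gamma> i))" using T(2) Ty y(2) by simp
      then have "H #> (x \<otimes> \<gamma> i) = H #> (y \<otimes> \<gamma> i)"
        using inj_onD[OF inj] rcosetsI[OF HG] x y(1) gi by simp
      then have "H #> x #> \<gamma> i #> inv \<gamma> i = H #> y #> \<gamma> i #> inv \<gamma> i"
        using x y(1) gi HG by (simp add: coset_mult_assoc)
      then have "H #> x = H #> y"
        using x y(1) gi HG by (simp add: coset_mult_assoc m_assoc)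
      then show "\<psi> (H #> x) = \<psi>' (H' #> x)" using y(2) by simp
    next
      assume "\<psi> (H #> x) = \<psi>' (H' #> x)"
      then show "\<psi> (H #> (x \<otimes> \<gamma> i)) = \<psi>' (H' #> (x \<otimes> \<gamma> i))" using T by simp
    qed
  qed
  have propagate: "\<psi> (H #> (x \<otimes> g)) = \<psi>' (H' #> (x \<otimes> g))"
    if "g \<in> generate G (\<gamma> ` {..<k})" "x \<in> carrier G" "\<psi> (H #> x) = \<psi>' (H' #> x)" for g x
    using that
  proof (induction g arbitrary: x)
    case one then show ?case by simp
  next
    case (incl h)
    then show ?case using step by auto
  next
    case (inv h)
    then obtain i where i: "i < k" "h = \<gamma> i" "h \<in> carrier G" using \<gamma> by auto
    show ?case using step[of "x \<otimes> inv h" i] i inv by (simp add: m_assoc)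
  next
    case (eng h1 h2)
    have "h1 \<in> carrier G" "h2 \<in> carrier G" using eng.hyps gen by auto
    then show ?case using eng.IH(2)[of "x \<otimes> h1"] eng.IH(1)[of x] eng.prems by (simp add: m_assoc)
  qed
  show ?thesis
    using propagate[of g \<one>] g gen \<psi>0 \<psi>'0 HG HG' by simp
qed

lemma subgroup_eq_zero_coset:
  assumes H: "subgroup H G" and \<psi>: "inj_on \<psi> (rcosets H)" and "\<psi> H = 0"
  shows "H = {g \<in> carrier G. \<psi> (H #> g) = (0::nat)}"
proof -
  have HG: "H \<subseteq> carrier G" using H by (rule subgroup.subset)
  have "\<psi> (H #> g) = 0 \<longleftrightarrow> g \<in> H" if g: "g \<in> carrier G" for g
  proof
    assume "\<psi> (H #> g) = 0"
    then have "H #> g = H"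
      using inj_onD[OF \<psi>] rcosetsI[OF HG g] subgroup.subgroup_in_rcosets[OF H is_group] assms(3) by metis
    then show "g \<in> H" using coset_join1[OF _ g H] by simp
  next
    assume "g \<in> H"
    then show "\<psi> (H #> g) = 0" using coset_join2[OF g H] assms(3) by simp
  qed
  then show ?thesis using HG by auto
qed

lemma exists_coset_numbering:
  assumes "subgroup H G" "finite (rcosets H)" "card (rcosets H) = n"
  shows "\<exists>\<phi>. bij_betw \<phi> (rcosets H) {..<n} \<and> \<phi> H = (0::nat)"
proof -
  have HH: "H \<in> rcosets H" using subgroup.subgroup_in_rcosets[OF assms(1) is_group] .
  then have n: "0 < n" using assms(2,3) card_gt_0_iff by blast
  obtain \<phi> where \<phi>: "bij_betw \<phi> (rcosets H) {..<n}"
    using finite_same_card_bij[OF assms(2), of "{..<n}"] assms(3) by auto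
  let ?s = "transpose (\<phi> H) 0"
  have "\<phi> H < n" using bij_betwE[OF \<phi>] HH by blast
  then have "?s permutes {..<n}" using n by (intro permutes_swap_id) auto
  then have "bij_betw (?s \<circ> \<phi>) (rcosets H) {..<n}"
    using bij_betw_trans[OF \<phi> permutes_imp_bij] by blast
  then show ?thesis by (intro exI[of _ "?s \<circ> \<phi>"]) simp
qed

text \<open>Every subgroup of index \<open>n\<close> has \<open>fact (n - 1)\<close> numberings of its cosets that give \<open>H\<close> the
number 0: they arise from one of them by the permutations of \<open>{1..<n}\<close>. The table of such a
numbering determines both the subgroup, which is the stabiliser of 0, and the numbering.\<close>
theorem num_subgroups_times_fact_le:
  assumes \<gamma>: "\<gamma> ` {..<k} \<subseteq> carrier G" and gen: "generate G (\<gamma> ` {..<k}) = carrier G"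
    and w: "nontrivial_positive_relation G k \<gamma> w" and n: "0 < n"
  shows "num_subgroups_of_index G n * fact (n - 1)
    \<le> card (closed_tables k (\<lambda>i. fst (w ! i)) (length w) n)"
proof -
  define A where "A = {H. subgroup H G \<and> finite (rcosets H) \<and> card (rcosets H) = n}"
  define \<phi> where "\<phi> H = (SOME \<phi>. bij_betw \<phi> (rcosets H) {..<n} \<and> \<phi> H = (0::nat))" for H
  have \<phi>: "bij_betw (\<phi> H) (rcosets H) {..<n}" "\<phi> H H = 0" if "H \<in> A" for H
    using someI_ex[OF exists_coset_numbering[of H n]] that unfolding A_def \<phi>_def by auto
  define Q where "Q = {\<pi>. \<pi> permutes {1..<n}}"
  have \<pi>\<phi>: "bij_betw (\<pi> \<circ> \<phi> H) (rcosets H) {..<n}" "(\<pi> \<circ> \<phi> H) H = 0"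
    if "H \<in> A" "\<pi> \<in> Q" for H \<pi>
  proof -
    have \<pi>: "\<pi> permutes {1..<n}" using that by (simp add: Q_def)
    then have "\<pi> permutes {..<n}" by (rule permutes_subset) auto
    then show "bij_betw (\<pi> \<circ> \<phi> H) (rcosets H) {..<n}"
      using bij_betw_trans[OF \<phi>(1)[OF that(1)] permutes_imp_bij] by blast
    show "(\<pi> \<circ> \<phi> H) H = 0" using permutes_not_in[OF \<pi>] \<phi>(2)[OF that(1)] by simp
  qed
  let ?F = "\<lambda>(H, \<pi>). coset_table G k \<gamma> n H (\<pi> \<circ> \<phi> H)"
  have "inj_on ?F (A \<times> Q)"
  proof (rule inj_onI, clarify)
    fix H \<pi> H' \<pi>'
    assume mem: "H \<in> A" "\<pi> \<in> Q" "H' \<in> A" "\<pi>' \<in> Q"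
      and eq: "coset_table G k \<gamma> n H (\<pi> \<circ> \<phi> H) = coset_table G k \<gamma> n H' (\<pi>' \<circ> \<phi> H')"
    have sub: "subgroup H G" "subgroup H' G" using mem by (auto simp: A_def)
    note b = \<pi>\<phi>[OF mem(1,2)] and b' = \<pi>\<phi>[OF mem(3,4)]
    have agree: "(\<pi> \<circ> \<phi> H) (H #> g) = (\<pi>' \<circ> \<phi> H') (H' #> g)" if "g \<in> carrier G" for g
      by (rule coset_table_determines_numbering[OF sub(1) b sub(2) b' \<gamma> gen eq that])
    have HH: "H = H'"
      using subgroup_eq_zero_coset[OF sub(1) bij_betw_imp_inj_on[OF b(1)] b(2)]
        subgroup_eq_zero_coset[OF sub(2) bij_betw_imp_inj_on[OF b'(1)] b'(2)] agree
      by (metis (mono_tags, lifting) Collect_cong)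
    have "\<pi> x = \<pi>' x" for x
    proof (cases "x < n")
      case True
      then obtain C where "C \<in> rcosets H" "x = \<phi> H C"
        using \<phi>(1)[OF mem(1)] by (metis bij_betw_imp_surj_on imageE lessThan_iff)
      then obtain g where "g \<in> carrier G" "x = \<phi> H (H #> g)" unfolding RCOSETS_def by auto
      then show ?thesis using agree HH by auto
    next
      case False
      then show ?thesis using mem(2,4) by (simp add: Q_def permutes_not_in)
    qed
    then show "H = H' \<and> \<pi> = \<pi>'" using HH by auto
  qed
  moreover have "?F ` (A \<times> Q) \<subseteq> closed_tables k (\<lambda>i. fst (w ! i)) (length w) n"
  proof clarify
    fix H \<pi> assume mem: "H \<in> A" "\<pi> \<in> Q"
    have "subgroup H G" using mem by (auto simp: A_def)
    from coset_table_closed[OF this \<pi>\<phi>(1)[OF mem] \<gamma> w]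
    show "coset_table G k \<gamma> n H (\<pi> \<circ> \<phi> H) \<in> closed_tables k (\<lambda>i. fst (w ! i)) (length w) n" .
  qed
  moreover have "finite (closed_tables k (\<lambda>i. fst (w ! i)) (length w) n)"
    unfolding closed_tables_def
    by (rule finite_subset[of _ "({..<k} \<times> {..<n}) \<rightarrow>\<^sub>E {..<n}"]) (auto intro: finite_PiE)
  ultimately have "card (A \<times> Q) \<le> card (closed_tables k (\<lambda>i. fst (w ! i)) (length w) n)"
    by (rule card_inj_on_le)
  moreover have "card Q = fact (n - 1)"
    unfolding Q_def by (rule card_permutations) auto
  ultimately show ?thesis
    by (simp add: card_cartesian_product num_subgroups_of_index_def A_def)
qed

end

section \<open>Comparison with powers of the factorial\<close>

lemma self_power_le_fact: "real n ^ n \<le> fact n * exp 1 ^ n"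
proof -
  have "real n ^ n / fact n \<le> exp (real n)"
    using sum_le_suminf[OF summable_exp[of "real n"], of "{n}"]
    by (simp add: exp_def scaleR_conv_of_real field_simps)
  also have "exp (real n) = exp 1 ^ n" by (simp add: exp_of_nat_mult[symmetric])
  finally show ?thesis by (simp add: field_simps)
qed

lemma eventually_power_le_fact: "\<forall>\<^sub>F n in sequentially. c ^ n \<le> (fact n :: real)"
proof -
  have "(\<lambda>n. c ^ n / fact n) \<longlonglongrightarrow> (0::real)"
    using summable_LIMSEQ_zero[OF summable_exp[of c]] by (simp add: field_simps)
  then have "\<forall>\<^sub>F n in sequentially. c ^ n / fact n < 1" by (rule order_tendstoD) simp
  then show ?thesis by eventually_elim simp
qed

text \<open>Since \<open>n ^ n\<close> is at most \<open>fact n * exp 1 ^ n\<close>, the hypothesis bounds \<open>a n\<close> by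
\<open>fact n powr (k - 1 - 1 / l)\<close> up to an exponential factor. Such a factor is eventually
smaller than \<open>fact n powr (1 / (2 * l))\<close>, which is the room between \<open>1 / l\<close> and
\<open>1 / (2 * l)\<close>.\<close>
lemma eventually_le_fact_powr:
  fixes a :: "nat \<Rightarrow> nat" and k l :: nat and C :: real
  assumes k: "1 \<le> k" and l: "1 \<le> l" and C: "1 \<le> C"
    and bound: "\<And>n. 0 < n \<Longrightarrow> real (a n * fact (n - 1)) \<le> C ^ n * real n powr (real k * n - real n / l)"
  shows "\<forall>\<^sub>F n in sequentially. real (a n) \<le> fact n powr (real k - 1 - 1 / (2 * real l))"
proof -
  \<comment> \<open>\<open>exp 1 ^ n\<close> bounds the quotient \<open>n\<close> of \<open>fact n\<close> and \<open>fact (n - 1)\<close>, and \<open>exp 1 ^ (k * n)\<close> is the loss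
    in passing from \<open>n ^ n\<close> to \<open>fact n\<close>.\<close>
  define D where "D = C * exp 1 * exp 1 ^ k"
  have D: "1 \<le> D" unfolding D_def using C by (intro mult_ge1_I) simp_all
  define s where "s = real k - 1 / real l"
  have s: "0 \<le> s" "s \<le> k" using k l unfolding s_def by (auto simp: field_simps intro: order_trans[of _ "real l"])
  show ?thesis
    using eventually_power_le_fact[of "D ^ (2 * l)"] eventually_gt_at_top[of 0]
  proof eventually_elim
    case (elim n)
    have nn: "real n powr (real k * n - real n / l) = (real n ^ n) powr s"
      using elim(2) by (simp add: powr_realpow[symmetric] powr_powr s_def algebra_simps)
    also have "\<dots> \<le> (fact n * exp 1 ^ n) powr s"
      using self_power_le_fact s(1) by (intro powr_mono2) auto
    also have "\<dots> = fact n powr s * (exp 1 ^ n) powr s" by (simp add: powr_mult)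
    also have "(exp 1 ^ n :: real) powr s \<le> (exp 1 ^ n) powr real k"
      using s(2) by (intro powr_mono) auto
    also have "(exp 1 ^ n :: real) powr real k = (exp 1 ^ k) ^ n"
      by (simp add: powr_realpow power_mult[symmetric] mult.commute)
    finally have 1: "real n powr (real k * n - real n / l) \<le> fact n powr s * (exp 1 ^ k) ^ n"
      by simp
    have "real n \<le> exp 1 ^ n"
    proof -
      have "real n \<le> exp (real n)" using exp_ge_add_one_self[of "real n"] by linarith
      then show ?thesis by (simp add: exp_of_nat_mult[symmetric])
    qed
    moreover have "fact n = real n * fact (n - 1)" using elim(2) by (simp add: fact_reduce)
    ultimately have "real (a n) * fact n \<le> exp 1 ^ n * real (a n * fact (n - 1))"
      using mult_right_mono[of "real n" "exp 1 ^ n" "real (a n * fact (n - 1))"]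
      by (simp add: mult.left_commute mult.commute)
    also have "\<dots> \<le> exp 1 ^ n * (C ^ n * (fact n powr s * (exp 1 ^ k) ^ n))"
      using bound[OF elim(2)] 1 C
      by (intro mult_left_mono order_trans[OF bound[OF elim(2)]]) auto
    also have "\<dots> = D ^ n * fact n powr s" by (simp add: D_def power_mult_distrib)
    also have "D ^ n \<le> fact n powr (1 / (2 * real l))"
    proof -
      have "D ^ n = ((D ^ n) ^ (2 * l)) powr (1 / (2 * real l))"
        using D l by (simp add: powr_realpow[symmetric] powr_powr)
      also have "\<dots> \<le> fact n powr (1 / (2 * real l))"
        using elim(1) D by (intro powr_mono2) (auto simp: power_mult[symmetric] mult.commute)
      finally show ?thesis .
    qed
    finally have "real (a n) * fact n \<le> fact n powr (1 / (2 * real l)) * fact n powr s"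
      by (simp add: mult_right_mono)
    also have "\<dots> = fact n powr (real k - 1 - 1 / (2 * real l)) * fact n"
      using l by (simp add: powr_add[symmetric] powr_mult_base s_def field_simps)
    finally show ?case by simp
  qed
qed

section \<open>The bound for groups with a positive relation\<close>

theorem corollary7:
  fixes \<Gamma> :: "('a, 'b) monoid_scheme" and k l :: nat and \<gamma> :: "nat \<Rightarrow> 'a"
  assumes "group \<Gamma>"
    and "\<gamma> ` {..<k} \<subseteq> carrier \<Gamma>"
    and "generate \<Gamma> (\<gamma> ` {..<k}) = carrier \<Gamma>"
    and "\<exists>w. nontrivial_positive_relation \<Gamma> k \<gamma> w"
    and "l = (LEAST m. \<exists>w. nontrivial_positive_relation \<Gamma> k \<gamma> w \<and> length w = m)"
  shows "\<exists>\<epsilon> :: nat \<Rightarrow> real. \<epsilon> \<longlonglongrightarrow> 0 \<and>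
    (\<forall>n\<ge>1. real (num_subgroups_of_index \<Gamma> n)
       \<le> (fact n :: real) powr (real k - 1 - 1 / (2 * real l) + \<epsilon> n))"
proof -
  interpret group \<Gamma> by (rule assms(1))
  let ?a = "num_subgroups_of_index \<Gamma>"
  define \<alpha> where "\<alpha> = real k - 1 - 1 / (2 * real l)"
  have "\<exists>w. nontrivial_positive_relation \<Gamma> k \<gamma> w \<and> length w = l"
    unfolding assms(5) by (rule LeastI_ex) (use assms(4) in blast)
  then obtain w where w: "nontrivial_positive_relation \<Gamma> k \<gamma> w" and len: "length w = l" by blast
  define u where "u = (\<lambda>i. fst (w ! i))"
  have "fst ` set w \<subseteq> {..<k}" "w \<noteq> []"
    using w by (auto simp: nontrivial_positive_relation_def free_group_words_def)
  then have u: "u i < k" if "i < l" for i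
    using nth_mem[of i w] that unfolding u_def len by blast
  have l: "0 < l" using \<open>w \<noteq> []\<close> len by auto
  have k: "1 \<le> k" using u[OF l] by simp
  have tables: "?a n * fact (n - 1) \<le> card (closed_tables k u l n)" if "0 < n" for n
    using num_subgroups_times_fact_le[OF assms(2,3) w that] by (simp add: u_def len)
  have large: "\<forall>\<^sub>F n in sequentially. real (?a n) \<le> fact n powr \<alpha>"
    unfolding \<alpha>_def
  proof (rule eventually_le_fact_powr[OF k])
    fix n :: nat assume n: "0 < n"
    show "real (?a n * fact (n - 1)) \<le> (2 ^ k * (real l + 1)) ^ n * real n powr (real k * n - real n / l)"
      using order_trans[OF of_nat_mono[OF tables[OF n]] card_closed_tables[OF u l n]] by simp
  qed (use l in \<open>auto intro: mult_ge1_I\<close>)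
  have one: "?a 1 \<le> 1"
  proof -
    have "card (closed_tables k u l 1) \<le> card (({..<k} \<times> {..<1::nat}) \<rightarrow>\<^sub>E {..<1::nat})"
      unfolding closed_tables_def by (intro card_mono finite_PiE) auto
    then show ?thesis using tables[of 1] by (simp add: card_PiE)
  qed
  \<comment> \<open>For the finitely many small \<open>n\<close>, the error term is the one that makes the bound an equality
    (with 1 in place of 0). This needs \<open>n > 1\<close>, because all powers of \<open>fact 1\<close> are 1.\<close>
  define \<epsilon> where "\<epsilon> n = (if real (?a n) \<le> fact n powr \<alpha> then 0
    else ln (max 1 (real (?a n))) / ln (fact n) - \<alpha>)" for n
  have "\<forall>\<^sub>F n in sequentially. \<epsilon> n = 0"
    using large by eventually_elim (simp add: \<epsilon>_def)
  then have "\<epsilon> \<longlonglongrightarrow> 0" by (rule tendsto_eventually)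
  moreover have "real (?a n) \<le> fact n powr (\<alpha> + \<epsilon> n)" if n: "n \<ge> 1" for n
  proof (cases "real (?a n) \<le> fact n powr \<alpha>")
    case True then show ?thesis by (simp add: \<epsilon>_def)
  next
    case False
    then have "n \<noteq> 1" using one by auto
    then have "fact 2 \<le> (fact n :: real)" using n by (intro fact_mono) simp
    then have "ln (fact n :: real) > 0" by (simp add: fact_2)
    then have "fact n powr (\<alpha> + \<epsilon> n) = max 1 (real (?a n))"
      using False by (simp add: \<epsilon>_def powr_def)
    then show ?thesis by simp
  qed
  ultimately show ?thesis unfolding \<alpha>_def by blast
qed

end
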